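(* Let $p\geq 1$ be an integer. For nonnegative integers $k,j_0,j_1,\ldots,j_p$, let $N_0(k,j_0,\ldots,j_p)$ be the number of noncrossing pair partitions $\pi\in\mathcal{NC}^2_{2pk}(W_0^k)$ with $j_l(\pi)=j_l$ for all $l\in\{0,1,\ldots,p\}$; equivalently, $N_0(k,j_0,\ldots,j_p)$ is the coefficient of $d_0^{j_0}d_1^{j_1}\cdots d_p^{j_p}$ in the polynomial $P_k(d_0,\ldots,d_p)$. Then $$N_0(k,j_0,\ldots,j_p)=\frac{1}{k}\binom{k}{j_0+1}\binom{k}{j_1}\cdots\binom{k}{j_p}$$ whenever $k\geq 1$ and $j_0+\cdots+j_p=pk$; moreover $N_0(0,0,\ldots,0)=1$, and in all other cases $N_0(k,j_0,\ldots,j_p)=0$.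
   Context: A noncrossing pair partition of $[m]=\{1,\ldots,m\}$ ($m$ even) is a partition of $[m]$ into two-element blocks such that there are no two blocks $\{a,b\}$ and $\{c,e\}$ with $a<c<b<e$. For a block $\{a,b\}$ with $a<b$, $b$ is called its right leg. The set of these partitions is $\mathcal{NC}^2_m$. Fix $p\geq 1$ and consider the letters $1,\ldots,p,1^*,\ldots,p^*$. Let $W_0=1\,2\cdots p\,p^*\cdots 2^*1^*$ (a word of length $2p$), and let $W_0^k$ be its $k$-fold concatenation (of length $2pk$). A partition $\pi\in\mathcal{NC}^2_{2pk}$ is adapted to $W_0^k$ if, for each block $\{a,b\}$ of $\pi$, the letters at positions $a$ and $b$ of $W_0^k$ are $l$ and $l^*$ in some order, for some $l\in\{1,\ldots,p\}$. The set of such partitions is $\mathcal{NC}^2_{2pk}(W_0^k)$; for $k=0$ it is $\{\emptyset\}$, i.e. it consists of the single empty partition. For $\pi\in\mathcal{NC}^2_{2pk}(W_0^k)$ let $\mathcal{R}_l(\pi)$ (resp. $\mathcal{R}_l^*(\pi)$) be the set of right legs of $\pi$ whose letter in $W_0^k$ is $l$ (resp. $l^*$), with $\mathcal{R}_0^*(\pi)=\emptyset$ and $\mathcal{R}_{p+1}(\pi)=\emptyset$. For $0\leq l\leq p$ put $j_l(\pi)=|\mathcal{R}_{l+1}(\pi)|+|\mathcal{R}_l^*(\pi)|$. Define $$P_k(d_0,\ldots,d_p)=\sum_{\pi\in\mathcal{NC}^2_{2pk}(W_0^k)}d_0^{j_0(\pi)}d_1^{j_1(\pi)}\cdots d_p^{j_p(\pi)}.$$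 Binomial coefficients $\binom{k}{j}$ with $j>k$ are zero. *)

theory Defs
  imports Complex_Main "HOL-Library.Disjoint_Sets" "HOL-Library.Poly_Mapping"
begin

definition nc_pair_partitions :: "nat \<Rightarrow> nat set set set" where
  "nc_pair_partitions m =
     {\<pi>. partition_on {1..m} \<pi> \<and> (\<forall>B\<in>\<pi>. card B = 2) \<and>
          \<not> (\<exists>a b c e. {a, b} \<in> \<pi> \<and> {c, e} \<in> \<pi> \<and> a < c \<and> c < b \<and> b < e)}"

datatype letter = Plain nat | Star nat

definition W0 :: "nat \<Rightarrow> letter list" where
  "W0 p = map Plain [1..<p + 1] @ map Star (rev [1..<p + 1])"

definition W0_power :: "nat \<Rightarrow> nat \<Rightarrow> letter list" where
  "W0_power p k = concat (replicate k (W0 p))"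

text \<open>Positions in a word are counted from 1, whereas list indices start at 0.\<close>

definition letter_at :: "letter list \<Rightarrow> nat \<Rightarrow> letter" where
  "letter_at w a = w ! (a - 1)"

definition adapted :: "nat \<Rightarrow> nat \<Rightarrow> nat set set \<Rightarrow> bool" where
  "adapted p k \<pi> \<longleftrightarrow>
     (\<forall>a b. {a, b} \<in> \<pi> \<longrightarrow>
        (\<exists>l\<in>{1..p}. {letter_at (W0_power p k) a, letter_at (W0_power p k) b} = {Plain l, Star l}))"

definition NC2 :: "nat \<Rightarrow> nat \<Rightarrow> nat set set set" where
  "NC2 p k = {\<pi> \<in> nc_pair_partitions (2 * p * k). adapted p k \<pi>}"

definition right_legs :: "nat set set \<Rightarrow> nat set" where
  "right_legs \<pi> = {b. \<exists>a. a < b \<and> {a, b} \<in> \<pi>}"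

text \<open>The letters \<open>Star 0\<close> and \<open>Plain (p + 1)\<close> do not occur in \<open>W0 p\<close>, so for
  \<open>\<pi> \<in> NC2 p k\<close> the conventions that \<open>R_star p k 0 \<pi>\<close> and \<open>R_plain p k (p + 1) \<pi>\<close>
  are empty hold without a separate clause.\<close>

definition R_plain :: "nat \<Rightarrow> nat \<Rightarrow> nat \<Rightarrow> nat set set \<Rightarrow> nat set" where
  "R_plain p k l \<pi> = {b \<in> right_legs \<pi>. letter_at (W0_power p k) b = Plain l}"

definition R_star :: "nat \<Rightarrow> nat \<Rightarrow> nat \<Rightarrow> nat set set \<Rightarrow> nat set" where
  "R_star p k l \<pi> = {b \<in> right_legs \<pi>. letter_at (W0_power p k) b = Star l}"

definition jstat :: "nat \<Rightarrow> nat \<Rightarrow> nat \<Rightarrow> nat set set \<Rightarrow> nat" where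
  "jstat p k l \<pi> = card (R_plain p k (l + 1) \<pi>) + card (R_star p k l \<pi>)"

text \<open>Multivariate polynomials are finitely supported maps from exponent vectors to
  coefficients; \<open>d_var l\<close> is the indeterminate $d_l$.\<close>

definition d_var :: "nat \<Rightarrow> (nat \<Rightarrow>\<^sub>0 nat) \<Rightarrow>\<^sub>0 int" where
  "d_var l = Poly_Mapping.single (Poly_Mapping.single l 1) 1"

definition P :: "nat \<Rightarrow> nat \<Rightarrow> (nat \<Rightarrow>\<^sub>0 nat) \<Rightarrow>\<^sub>0 int" where
  "P p k = (\<Sum>\<pi>\<in>NC2 p k. \<Prod>l\<le>p. d_var l ^ jstat p k l \<pi>)"

text \<open>A tuple $(j_0, \ldots, j_p)$ is a function on the naturals of which only the values
  at \<open>0, \<dots>, p\<close> matter.\<close>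

definition N0 :: "nat \<Rightarrow> nat \<Rightarrow> (nat \<Rightarrow> nat) \<Rightarrow> nat" where
  "N0 p k j = card {\<pi> \<in> NC2 p k. \<forall>l\<le>p. jstat p k l \<pi> = j l}"

end

theory Submission
  imports Defs "HOL-Computational_Algebra.Formal_Power_Series"
begin

text \<open>
  Call the \<open>2pk + 1\<close> places before, between and after the letters of \<open>W\<^sub>0\<^sup>k\<close> gaps, numbered from
  \<open>0\<close>. Reading a copy of \<open>W\<^sub>0\<close> is a walk through the levels \<open>0, 1, \<dots>, p, \<dots>, 1, 0\<close>: the letter
  \<open>l\<close> leads from level \<open>l - 1\<close> up to level \<open>l\<close>, the letter \<open>l\<^sup>*\<close> back down. Two letters may form a
  block exactly if they traverse the same step of the walk in opposite directions, so an adapted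
  partition folds the word into a plane tree whose edges are the blocks and whose vertices carry
  levels. The right leg of a block lies at \<open>l + 1\<close> or \<open>l\<^sup>*\<close> exactly if the gap just before
  it has level \<open>l\<close>. Hence \<open>j\<^sub>l\<close> counts the blocks that enclose a vertex of level \<open>l\<close>.

  The block of the first letter separates a partition into the part it encloses and the
  part to its right (\<open>nc_sum_rec\<close>). For generating functions in a variable that
  marks letters this becomes a quadratic system indexed by the gaps modulo \<open>2p\<close>
  (\<open>walk_gf_rec\<close>). Let \<open>u\<^sub>l\<close> and \<open>v\<^sub>l\<close> be the series of the closed subwords
  that start and end at level \<open>l\<close> heading upwards and downwards respectively. Eliminating the other
  unknowns from the system gives
    \<open>d\<^sub>l u\<^sub>l = d\<^sub>l + Z\<^bsub>l+1\<^esub>\<close> and \<open>d\<^sub>l v\<^sub>l = d\<^sub>l + Z\<^sub>l\<close>, where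
    \<open>Z\<^sub>l = z\<^bsup>2p\<^esup> (d\<^sub>0 u\<^sub>0) \<dots> (d\<^bsub>l-1\<^esub> u\<^bsub>l-1\<^esub>) (d\<^sub>l v\<^sub>l) \<dots> (d\<^sub>p v\<^sub>p)\<close>.
  As \<open>Z\<^sub>l\<close> and \<open>Z\<^bsub>l+1\<^esub>\<close> differ in one factor only, namely \<open>d\<^sub>l v\<^sub>l\<close> and
  \<open>d\<^sub>l u\<^sub>l\<close>, cross-multiplication and cancelling \<open>d\<^sub>l\<close> give \<open>Z\<^sub>l = Z\<^bsub>l+1\<^esub>\<close>. The common value \<open>Q\<close> satisfies
  \<open>Q = z\<^bsup>2p\<^esup> \<Prod>\<^sub>l (d\<^sub>l + Q)\<close>, the equation of \<open>(p + 1)\<close>-ary trees with weight \<open>d\<^sub>l\<close> on the empty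
  places of type \<open>l\<close>, and \<open>d\<^sub>0 P\<^sub>k\<close> is the coefficient of \<open>z\<^bsup>2pk\<^esup>\<close> in \<open>Q\<close> for \<open>k \<ge> 1\<close>
  (\<open>walk_gf_functional_equation\<close>).

  Lagrange inversion (\<open>lagrange_inversion_power\<close>) then gives that \<open>k d\<^sub>0 P\<^sub>k\<close> is the coefficient of
  \<open>x\<^bsup>k-1\<^esup>\<close> in \<open>\<Prod>\<^sub>l (d\<^sub>l + x)\<^sup>k\<close>. This explains the product of binomial coefficients, the factor
  \<open>1/k\<close> and, through the factor \<open>d\<^sub>0\<close>, the shift from \<open>j\<^sub>0\<close> to \<open>j\<^sub>0 + 1\<close>.
\<close>

unbundle fps_syntax

section \<open>Noncrossing pairings and the block of the first point\<close>

definition nc_pairings :: "nat set \<Rightarrow> nat set set set" where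
  "nc_pairings A =
     {\<pi>. partition_on A \<pi> \<and> (\<forall>B\<in>\<pi>. card B = 2) \<and>
          \<not> (\<exists>a b c e. {a, b} \<in> \<pi> \<and> {c, e} \<in> \<pi> \<and> a < c \<and> c < b \<and> b < e)}"

lemma finite_nc_pairings: "finite A \<Longrightarrow> finite (nc_pairings A)"
  by (rule finite_subset[of _ "Pow (Pow A)"]) (auto simp: nc_pairings_def partition_on_def)

lemma nc_pairings_empty [simp]: "nc_pairings {} = {{}}"
  by (auto simp: nc_pairings_def partition_on_empty)

lemma nc_pairingsI:
  assumes "partition_on A \<pi>" "\<And>B. B \<in> \<pi> \<Longrightarrow> card B = 2"
    "\<And>a b c e. {a, b} \<in> \<pi> \<Longrightarrow> {c, e} \<in> \<pi> \<Longrightarrow> a < c \<Longrightarrow> c < b \<Longrightarrow> b < e \<Longrightarrow> False"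
  shows "\<pi> \<in> nc_pairings A"
  using assms unfolding nc_pairings_def by blast

lemma nc_pairingsD:
  assumes "\<pi> \<in> nc_pairings A"
  shows "partition_on A \<pi>" "\<And>B. B \<in> \<pi> \<Longrightarrow> card B = 2"
    "\<And>a b c e. {a, b} \<in> \<pi> \<Longrightarrow> {c, e} \<in> \<pi> \<Longrightarrow> a < c \<Longrightarrow> c < b \<Longrightarrow> b < e \<Longrightarrow> False"
  using assms unfolding nc_pairings_def by blast+

lemma nc_pairings_block_subset:
  "\<pi> \<in> nc_pairings A \<Longrightarrow> B \<in> \<pi> \<Longrightarrow> B \<subseteq> A"
  by (auto simp: nc_pairings_def partition_on_def)

lemma nc_pairings_block:
  assumes "\<pi> \<in> nc_pairings A" "B \<in> \<pi>"
  obtains x y where "B = {x, y}" "x < y" "x \<in> A" "y \<in> A"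
proof -
  obtain x y where "B = {x, y}" "x \<noteq> y"
    using nc_pairingsD(2)[OF assms] by (auto simp: card_2_iff)
  then show ?thesis
    using nc_pairings_block_subset[OF assms] that[of x y] that[of y x]
    by (cases x y rule: linorder_cases) (auto simp: insert_commute)
qed

lemma nc_pairings_restrict:
  assumes \<pi>: "\<pi> \<in> nc_pairings A" and "C \<subseteq> A"
    and sep: "\<And>B. B \<in> \<pi> \<Longrightarrow> B \<subseteq> C \<or> B \<inter> C = {}"
  shows "{B \<in> \<pi>. B \<subseteq> C} \<in> nc_pairings C"
proof -
  note part = nc_pairingsD(1)[OF \<pi>]
  have "partition_on C {B \<in> \<pi>. B \<subseteq> C}"
  proof (rule partition_onI)
    show "\<Union> {B \<in> \<pi>. B \<subseteq> C} = C"
    proof (intro equalityI subsetI)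
      fix x assume "x \<in> C"
      then obtain B where B: "B \<in> \<pi>" "x \<in> B"
        using part \<open>C \<subseteq> A\<close> by (auto simp: partition_on_def)
      with sep[OF B(1)] \<open>x \<in> C\<close> show "x \<in> \<Union> {B \<in> \<pi>. B \<subseteq> C}" by auto
    qed auto
  qed (use part in \<open>auto simp: partition_on_def disjoint_def disjnt_def\<close>)
  then show ?thesis
    by (rule nc_pairingsI) (auto dest: nc_pairingsD(2)[OF \<pi>] nc_pairingsD(3)[OF \<pi>])
qed

lemma partition_on_Un:
  "partition_on A \<pi> \<Longrightarrow> partition_on B \<sigma> \<Longrightarrow> A \<inter> B = {} \<Longrightarrow> partition_on (A \<union> B) (\<pi> \<union> \<sigma>)"
  unfolding partition_on_def by (simp add: disjoint_union)

lemma nc_pairings_insert: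
  assumes \<pi>1: "\<pi>1 \<in> nc_pairings {Suc a<..e}" and \<pi>2: "\<pi>2 \<in> nc_pairings {Suc e<..b}"
    and "a < e" "e < b"
  shows "insert {Suc a, Suc e} (\<pi>1 \<union> \<pi>2) \<in> nc_pairings {a<..b}" (is "?\<pi> \<in> _")
proof -
  have split: "{a<..b} = {Suc a, Suc e} \<union> ({Suc a<..e} \<union> {Suc e<..b})"
    using \<open>a < e\<close> \<open>e < b\<close> by auto
  have "partition_on ({Suc a<..e} \<union> {Suc e<..b}) (\<pi>1 \<union> \<pi>2)"
    by (rule partition_on_Un) (use nc_pairingsD(1)[OF \<pi>1] nc_pairingsD(1)[OF \<pi>2] in auto)
  from partition_on_Un[OF partition_on_space this, of "{Suc a, Suc e}"]
  have part: "partition_on {a<..b} ?\<pi>"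
    unfolding split using \<open>a < e\<close> by simp
  have card: "card B = 2" if "B \<in> ?\<pi>" for B
    using that nc_pairingsD(2)[OF \<pi>1] nc_pairingsD(2)[OF \<pi>2] \<open>a < e\<close> by auto
  have bl1: "x \<in> {Suc a<..e} \<and> y \<in> {Suc a<..e}" if "{x, y} \<in> \<pi>1" for x y
    using nc_pairings_block_subset[OF \<pi>1 that] by auto
  have bl2: "x \<in> {Suc e<..b} \<and> y \<in> {Suc e<..b}" if "{x, y} \<in> \<pi>2" for x y
    using nc_pairings_block_subset[OF \<pi>2 that] by auto
  have False if *: "{x, y} \<in> ?\<pi>" "{u, v} \<in> ?\<pi>" "x < u" "u < y" "y < v" for x y u v
  proof -
    have "{x, y} = {Suc a, Suc e} \<or> {x, y} \<in> \<pi>1 \<or> {x, y} \<in> \<pi>2"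
      "{u, v} = {Suc a, Suc e} \<or> {u, v} \<in> \<pi>1 \<or> {u, v} \<in> \<pi>2"
      using *(1,2) by auto
    then show False
      using *(3-5) bl1[of x y] bl1[of u v] bl2[of x y] bl2[of u v] \<open>a < e\<close> 
        nc_pairingsD(3)[OF \<pi>1, of x y u v] nc_pairingsD(3)[OF \<pi>2, of x y u v]
      by (elim disjE) (auto simp: doubleton_eq_iff)
  qed
  with part card show ?thesis
    by (rule nc_pairingsI)
qed

text \<open>The partner \<open>e + 1\<close> of the first position \<open>a + 1\<close> splits the rest: no block has points on both
  sides of \<open>e + 1\<close>, because it would cross \<open>{a + 1, e + 1}\<close>.\<close>

lemma nc_pairings_split:
  assumes \<pi>: "\<pi> \<in> nc_pairings {a<..b}" and "a < b"
  obtains e where "a < e" "e < b"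
    "{B \<in> \<pi>. B \<subseteq> {Suc a<..e}} \<in> nc_pairings {Suc a<..e}"
    "{B \<in> \<pi>. B \<subseteq> {Suc e<..b}} \<in> nc_pairings {Suc e<..b}"
    "\<pi> = insert {Suc a, Suc e} ({B \<in> \<pi>. B \<subseteq> {Suc a<..e}} \<union> {B \<in> \<pi>. B \<subseteq> {Suc e<..b}})"
proof -
  note part = nc_pairingsD(1)[OF \<pi>]
  obtain B where B: "B \<in> \<pi>" "Suc a \<in> B"
    using part \<open>a < b\<close> unfolding partition_on_def by (metis UnionE Suc_leI greaterThanAtMost_iff lessI)
  obtain x y where xy: "B = {x, y}" "x < y" "x \<in> {a<..b}" "y \<in> {a<..b}"
    using nc_pairings_block[OF \<pi> B(1)] .
  with B(2) have "x = Suc a" by auto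
  define e where "e = y - 1"
  have e: "a < e" "e < b" "B = {Suc a, Suc e}"
    using xy \<open>x = Suc a\<close> by (auto simp: e_def)
  have sep: "C = {Suc a, Suc e} \<or> C \<subseteq> {Suc a<..e} \<or> C \<subseteq> {Suc e<..b}" if C: "C \<in> \<pi>" for C
  proof (cases "C = B")
    case False
    then have disj: "C \<inter> B = {}"
      using part C B(1) by (auto simp: partition_on_def disjoint_def)
    obtain u v where uv: "C = {u, v}" "u < v" "u \<in> {a<..b}" "v \<in> {a<..b}"
      using nc_pairings_block[OF \<pi> C] .
    have "\<not> (Suc a < u \<and> u < Suc e \<and> Suc e < v)"
      using nc_pairingsD(3)[OF \<pi>, of "Suc a" "Suc e" u v] B(1) C uv(1) e(3) by auto
    then show ?thesis
      using uv disj e(3) by auto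
  qed (use e in simp)
  define L R where "L = {Suc a<..e}" and "R = {Suc e<..b}"
  have sub: "L \<subseteq> {a<..b}" "R \<subseteq> {a<..b}"
    using e by (auto simp: L_def R_def)
  have disj: "L \<inter> R = {}" "B \<inter> L = {}" "B \<inter> R = {}"
    using e by (auto simp: L_def R_def)
  note sep = sep[folded L_def R_def e(3)]
  show ?thesis
  proof (rule that[OF e(1,2)], unfold L_def[symmetric] R_def[symmetric] e(3)[symmetric])
    show "{C \<in> \<pi>. C \<subseteq> L} \<in> nc_pairings L" "{C \<in> \<pi>. C \<subseteq> R} \<in> nc_pairings R"
      using sep disj by (blast intro!: nc_pairings_restrict[OF \<pi>] sub)+
    show "\<pi> = insert B ({C \<in> \<pi>. C \<subseteq> L} \<union> {C \<in> \<pi>. C \<subseteq> R})"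
      using sep B(1) by blast
  qed
qed

text \<open>The three pieces of the decomposition can be read off the pairing, so that the decomposition is
  unique and the weight of a pairing is the product of the weights of the pieces.\<close>

lemma nc_pairings_parts:
  assumes \<pi>1: "\<pi>1 \<in> nc_pairings {Suc a<..e}" and \<pi>2: "\<pi>2 \<in> nc_pairings {Suc e<..b}"
    and "a < e"
  defines "\<pi> \<equiv> insert {Suc a, Suc e} (\<pi>1 \<union> \<pi>2)"
  shows "{Suc a, Suc e'} \<in> \<pi> \<longleftrightarrow> e' = e"
    "{B \<in> \<pi>. B \<subseteq> {Suc a<..e}} = \<pi>1" "{B \<in> \<pi>. B \<subseteq> {Suc e<..b}} = \<pi>2"
    "{Suc a, Suc e} \<notin> \<pi>1 \<union> \<pi>2" "\<pi>1 \<inter> \<pi>2 = {}"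
proof -
  define D L R where "D = {Suc a, Suc e}" and "L = {Suc a<..e}" and "R = {Suc e<..b}"
  have 1: "B \<subseteq> L" "B \<noteq> {}" if "B \<in> \<pi>1" for B
    using nc_pairings_block_subset[OF \<pi>1 that] nc_pairingsD(2)[OF \<pi>1 that] by (auto simp: L_def)
  have 2: "B \<subseteq> R" "B \<noteq> {}" if "B \<in> \<pi>2" for B
    using nc_pairings_block_subset[OF \<pi>2 that] nc_pairingsD(2)[OF \<pi>2 that] by (auto simp: R_def)
  have disj: "L \<inter> R = {}" "\<not> D \<subseteq> L" "\<not> D \<subseteq> R"
    by (auto simp: D_def L_def R_def)
  show "{B \<in> \<pi>. B \<subseteq> {Suc a<..e}} = \<pi>1" "{B \<in> \<pi>. B \<subseteq> {Suc e<..b}} = \<pi>2"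
    unfolding \<pi>_def L_def[symmetric] R_def[symmetric] D_def[symmetric]
    using 1 2 disj by blast+
  show "\<pi>1 \<inter> \<pi>2 = {}"
    using 1 2 disj by blast
  show "{Suc a, Suc e} \<notin> \<pi>1 \<union> \<pi>2"
    using 1 2 disj unfolding D_def by blast
  show "{Suc a, Suc e'} \<in> \<pi> \<longleftrightarrow> e' = e"
    using 1(1)[of "{Suc a, Suc e'}"] 2(1)[of "{Suc a, Suc e'}"] \<open>a < e\<close>
    by (auto simp: \<pi>_def L_def R_def doubleton_eq_iff)
qed

text \<open>The interval \<open>{a<..b}\<close> of positions consists of the letters between gap \<open>a\<close> and gap \<open>b\<close>. The
  weights sit on blocks, so that forbidden pairs can be excluded by giving them weight \<open>0\<close>.\<close>

definition nc_sum :: "(nat set \<Rightarrow> 'a :: comm_ring_1) \<Rightarrow> nat \<Rightarrow> nat \<Rightarrow> 'a" where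
  "nc_sum w a b = (\<Sum>\<pi>\<in>nc_pairings {a<..b}. \<Prod>B\<in>\<pi>. w B)"

lemma nc_sum_empty [simp]: "nc_sum w a a = 1"
  by (simp add: nc_sum_def)

text \<open>The first letter, at position \<open>a + 1\<close>, is paired with the letter after gap \<open>e\<close>.
  This block encloses the gaps \<open>a + 1, \<dots>, e\<close>, and everything from gap \<open>e + 1\<close> on is outside.\<close>

lemma nc_sum_rec:
  assumes "a < b"
  shows "nc_sum w a b = (\<Sum>e\<in>{Suc a..<b}. w {Suc a, Suc e} * nc_sum w (Suc a) e * nc_sum w (Suc e) b)"
proof -
  let ?I = "SIGMA e:{Suc a..<b}. nc_pairings {Suc a<..e} \<times> nc_pairings {Suc e<..b}"
  let ?f = "\<lambda>(e, \<pi>1, \<pi>2). insert {Suc a, Suc e} (\<pi>1 \<union> \<pi>2)"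
  have inj: "inj_on ?f ?I"
  proof (rule inj_onI)
    fix x x' assume "x \<in> ?I" "x' \<in> ?I" "?f x = ?f x'"
    moreover obtain e \<pi>1 \<pi>2 e' \<pi>1' \<pi>2' where x: "x = (e, \<pi>1, \<pi>2)" "x' = (e', \<pi>1', \<pi>2')"
      by (cases x, cases x')
    ultimately have *: "e \<in> {Suc a..<b}" "\<pi>1 \<in> nc_pairings {Suc a<..e}" "\<pi>2 \<in> nc_pairings {Suc e<..b}"
      "e' \<in> {Suc a..<b}" "\<pi>1' \<in> nc_pairings {Suc a<..e'}" "\<pi>2' \<in> nc_pairings {Suc e'<..b}"
      and eq: "insert {Suc a, Suc e} (\<pi>1 \<union> \<pi>2) = insert {Suc a, Suc e'} (\<pi>1' \<union> \<pi>2')"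
      by simp_all
    have "a < e" "a < e'" using * by auto
    note parts = nc_pairings_parts[OF *(2,3) \<open>a < e\<close>]
      and parts' = nc_pairings_parts[OF *(5,6) \<open>a < e'\<close>]
    have "e' = e" using parts(1)[of e'] unfolding eq by simp
    moreover have "\<pi>1' = \<pi>1" "\<pi>2' = \<pi>2"
      using parts(2,3) parts'(2,3) unfolding eq \<open>e' = e\<close> by simp_all
    ultimately show "x = x'" by (simp add: x)
  qed
  have surj: "?f ` ?I = nc_pairings {a<..b}"
  proof (intro equalityI subsetI)
    fix \<pi> assume "\<pi> \<in> nc_pairings {a<..b}"
    from nc_pairings_split[OF this \<open>a < b\<close>]
    obtain e where e: "a < e" "e < b"
      "{B \<in> \<pi>. B \<subseteq> {Suc a<..e}} \<in> nc_pairings {Suc a<..e}"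
      "{B \<in> \<pi>. B \<subseteq> {Suc e<..b}} \<in> nc_pairings {Suc e<..b}"
      "\<pi> = insert {Suc a, Suc e} ({B \<in> \<pi>. B \<subseteq> {Suc a<..e}} \<union> {B \<in> \<pi>. B \<subseteq> {Suc e<..b}})" .
    show "\<pi> \<in> ?f ` ?I"
    proof (rule image_eqI)
      show "\<pi> = ?f (e, {B \<in> \<pi>. B \<subseteq> {Suc a<..e}}, {B \<in> \<pi>. B \<subseteq> {Suc e<..b}})"
        unfolding split using e(5) .
    qed (use e in simp)
  qed (auto intro!: nc_pairings_insert)
  have W: "(\<Prod>B\<in>insert {Suc a, Suc e} (\<pi>1 \<union> \<pi>2). w B) =
      w {Suc a, Suc e} * (\<Prod>B\<in>\<pi>1. w B) * (\<Prod>B\<in>\<pi>2. w B)"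
    if "e \<in> {Suc a..<b}" "\<pi>1 \<in> nc_pairings {Suc a<..e}" "\<pi>2 \<in> nc_pairings {Suc e<..b}" for e \<pi>1 \<pi>2
  proof -
    have fin: "finite \<pi>1" "finite \<pi>2"
      using that nc_pairingsD(1) finite_elements finite_greaterThanAtMost by metis+
    have "a < e" using that by auto
    note parts = nc_pairings_parts[OF that(2,3) this]
    show ?thesis
      using fin parts(4,5) by (simp add: prod.union_disjoint mult.assoc)
  qed
  have "nc_sum w a b = (\<Sum>x\<in>?I. \<Prod>B\<in>?f x. w B)"
    unfolding nc_sum_def surj[symmetric] by (rule sum.reindex_cong[OF inj]) auto
  also have "\<dots> = (\<Sum>(e, \<pi>1, \<pi>2)\<in>?I. w {Suc a, Suc e} * (\<Prod>B\<in>\<pi>1. w B) * (\<Prod>B\<in>\<pi>2. w B))"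
    by (rule sum.cong) (auto simp: W)
  also have "\<dots> = (\<Sum>e\<in>{Suc a..<b}. \<Sum>\<pi>1\<in>nc_pairings {Suc a<..e}. \<Sum>\<pi>2\<in>nc_pairings {Suc e<..b}.
      w {Suc a, Suc e} * (\<Prod>B\<in>\<pi>1. w B) * (\<Prod>B\<in>\<pi>2. w B))"
    by (simp add: sum.Sigma sum.cartesian_product finite_nc_pairings)
  also have "\<dots> = (\<Sum>e\<in>{Suc a..<b}. w {Suc a, Suc e} * nc_sum w (Suc a) e * nc_sum w (Suc e) b)"
    unfolding nc_sum_def mult.assoc sum_product by (simp only: sum_distrib_left)
  finally show ?thesis .
qed

section \<open>Generating functions of adapted pairings of subwords\<close>

text \<open>The height at a gap of the periodic zigzag \<open>0, 1, \<dots>, p, \<dots>, 1, 0, 1, \<dots>\<close>.\<close>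

definition level :: "nat \<Rightarrow> nat \<Rightarrow> nat" where
  "level p e = (let r = e mod (2 * p) in if r \<le> p then r else 2 * p - r)"

text \<open>The letter at position \<open>x\<close> is the step from gap \<open>x - 1\<close> to gap \<open>x\<close>. Letters at positions
  \<open>x < y\<close> are steps in opposite directions between the same two levels if and only if
  the gaps \<open>x - 1\<close> and \<open>y\<close> are reflections of each other, that is, \<open>2p\<close> divides
  \<open>x + y - 1\<close>. The gap \<open>y - 1\<close> then has the level of the vertex that the block encloses. Blocks that
  are not adapted get weight \<open>0\<close> and thereby drop out of all sums.\<close>

definition block_weight :: "nat \<Rightarrow> (nat \<Rightarrow> 'a :: comm_ring_1) \<Rightarrow> nat set \<Rightarrow> 'a" where
  "block_weight p d B =
     (if 2 * p dvd Min B + Max B - 1 then d (level p (Max B - 1)) else 0)"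

abbreviation walk_sum :: "nat \<Rightarrow> (nat \<Rightarrow> 'a :: comm_ring_1) \<Rightarrow> nat \<Rightarrow> nat \<Rightarrow> 'a" where
  "walk_sum p d t n \<equiv> nc_sum (block_weight p d) t (t + n)"

lemma level_mod: "a mod (2 * p) = b mod (2 * p) \<Longrightarrow> level p a = level p b"
  by (simp add: level_def)

text \<open>The walk \<open>0, 1, \<dots>, p, \<dots>, 1, 0\<close> is a palindrome.\<close>

lemma level_reflect:
  assumes "2 * p dvd a + b" shows "level p a = level p b"
proof (cases "p = 0")
  case False
  have "2 * p dvd a mod (2 * p) + b mod (2 * p)"
    using assms by (metis dvd_eq_mod_eq_0 mod_add_eq)
  then obtain q where q: "a mod (2 * p) + b mod (2 * p) = (2 * p) * q" ..
  have "a mod (2 * p) < 2 * p" "b mod (2 * p) < 2 * p"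
    using False by simp_all
  with q have "2 * p * q < 2 * p * 2" by linarith
  then have "q < 2" by simp
  with q have "a mod (2 * p) + b mod (2 * p) = 0 \<or> a mod (2 * p) + b mod (2 * p) = 2 * p"
    by (auto simp: less_2_cases_iff)
  then show ?thesis
    by (auto simp: level_def Let_def)
qed (use assms in simp)

lemma level_le [simp]: "l \<le> p \<Longrightarrow> level p l = l"
  by (cases "p = 0") (auto simp: level_def Let_def)

lemma level_diff: "l \<le> p \<Longrightarrow> level p (2 * p - l) = l"
  using level_reflect[of p "2 * p - l" l] by simp

lemma block_weight_pair:
  "block_weight p d {Suc t, Suc (Suc t + i)} =
     (if 2 * p dvd 2 * Suc t + i then d (level p (Suc t + i)) else 0)"
proof -
  have "Min {Suc t, Suc (Suc t + i)} = Suc t" "Max {Suc t, Suc (Suc t + i)} = Suc (Suc t + i)"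
    "Suc t + Suc (Suc t + i) - 1 = 2 * Suc t + i" "Suc (Suc t + i) - 1 = Suc t + i"
    by auto
  then show ?thesis by (simp only: block_weight_def)
qed

lemma nc_sum_singleton [simp]: "nc_sum w t (Suc t) = 0"
  by (simp add: nc_sum_rec)

text \<open>The first-block decomposition, with the summation index \<open>i\<close> being the number of letters
  that the first block encloses.\<close>

lemma walk_sum_Suc_Suc:
  "walk_sum p d t (Suc (Suc n)) =
     (\<Sum>i\<le>n. (if 2 * p dvd 2 * Suc t + i then d (level p (Suc t + i)) else 0) *
        walk_sum p d (Suc t) i * walk_sum p d (t + 2 + i) (n - i))"
proof -
  have "walk_sum p d t (Suc (Suc n)) = (\<Sum>e\<in>{Suc t..<t + Suc (Suc n)}. block_weight p d {Suc t, Suc e} *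
      nc_sum (block_weight p d) (Suc t) e * nc_sum (block_weight p d) (Suc e) (t + Suc (Suc n)))"
    by (rule nc_sum_rec) simp
  also have "\<dots> = (\<Sum>i\<le>n. block_weight p d {Suc t, Suc (Suc t + i)} *
      walk_sum p d (Suc t) i * nc_sum (block_weight p d) (Suc (Suc t + i)) (t + Suc (Suc n)))"
    by (rule sum.reindex_bij_witness[of _ "\<lambda>i. Suc t + i" "\<lambda>e. e - Suc t"]) auto
  also have "\<dots> = (\<Sum>i\<le>n. (if 2 * p dvd 2 * Suc t + i then d (level p (Suc t + i)) else 0) *
        walk_sum p d (Suc t) i * walk_sum p d (t + 2 + i) (n - i))"
    unfolding block_weight_pair by (rule sum.cong) simp_all
  finally show ?thesis .
qed

lemma walk_sum_periodic:
  "a mod (2 * p) = b mod (2 * p) \<Longrightarrow> walk_sum p d a n = walk_sum p d b n"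
proof (induction n arbitrary: a b rule: less_induct)
  case (less n)
  have shift: "(a + k) mod (2 * p) = (b + k) mod (2 * p)" for k
    using less.prems by (metis mod_add_cong)
  consider "n = 0" | "n = Suc 0" | m where "n = Suc (Suc m)"
    by (metis not0_implies_Suc)
  then show ?case
  proof cases
    case (3 m)
    have 1: "walk_sum p d (Suc a) i = walk_sum p d (Suc b) i" if "i \<le> m" for i
      using less.IH[OF _ shift[of 1], of i] that 3 by simp
    have 2: "walk_sum p d (a + 2 + i) (m - i) = walk_sum p d (b + 2 + i) (m - i)" for i
      using less.IH[OF _ shift[of "2 + i"], of "m - i"] 3 by (simp add: add.assoc)
    have 3: "level p (Suc a + i) = level p (Suc b + i)" for i
      using level_mod[OF shift[of "Suc i"]] by simp
    have 4: "2 * p dvd 2 * Suc a + i \<longleftrightarrow> 2 * p dvd 2 * Suc b + i" for i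
    proof -
      have "2 * Suc x + i = (x + 1) + (x + (1 + i))" for x :: nat
        by simp
      then show ?thesis
        by (simp only: dvd_eq_mod_eq_0 mod_add_cong[OF shift shift])
    qed
    show ?thesis
      unfolding \<open>n = Suc (Suc m)\<close> walk_sum_Suc_Suc
      by (rule sum.cong) (simp_all only: 1 2 3 4 atMost_iff)
  qed simp_all
qed

text \<open>The generating function, with one factor \<open>z\<close> for each letter, of the subwords that start at gap
  \<open>t\<close> and end at a gap congruent to \<open>-r\<close> modulo \<open>2p\<close>. The end is encoded by its negative so that
  the condition on it is a divisibility of natural numbers without subtraction.\<close>

definition walk_gf :: "nat \<Rightarrow> (nat \<Rightarrow> 'a :: comm_ring_1) \<Rightarrow> nat \<Rightarrow> nat \<Rightarrow> 'a fps" where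
  "walk_gf p d t r = Abs_fps (\<lambda>n. if 2 * p dvd t + n + r then walk_sum p d t n else 0)"

lemma walk_gf_shift_start: "walk_gf p d (2 * p + t) r = walk_gf p d t r"
proof -
  have "walk_sum p d (2 * p + t) n = walk_sum p d t n" for n
    by (rule walk_sum_periodic) simp
  moreover have "2 * p dvd 2 * p + t + n + r \<longleftrightarrow> 2 * p dvd t + n + r" for n
    by (simp add: add.assoc)
  ultimately show ?thesis
    by (simp only: walk_gf_def)
qed

lemma walk_gf_shift_end: "walk_gf p d t (2 * p + r) = walk_gf p d t r"
  by (simp add: walk_gf_def add.left_commute[of _ "2 * p"])

text \<open>A nonempty subword starts with a letter from gap \<open>t\<close> to \<open>t + 1\<close>. Its partner leads from a gap
  congruent to \<open>-(t + 1)\<close> to one congruent to \<open>-t\<close>: the enclosed subword is therefore of the type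
  \<open>walk_gf p d (Suc t) (Suc t)\<close>, and the subword to the right starts at a gap congruent to
  \<open>2p - t\<close>. By reflection the gap before the right leg has the level of \<open>t + 1\<close>.\<close>

lemma walk_gf_rec:
  assumes "t \<le> 2 * p"
  shows "walk_gf p d t r = (if 2 * p dvd t + r then 1 else 0) +
    fps_X ^ 2 * fps_const (d (level p (Suc t))) * walk_gf p d (Suc t) (Suc t) * walk_gf p d (2 * p - t) r"
    (is "_ = ?I + ?R")
proof (rule fps_ext)
  fix n
  have R: "?R = fps_X ^ 2 * (fps_const (d (level p (Suc t))) * (walk_gf p d (Suc t) (Suc t) * walk_gf p d (2 * p - t) r))"
    by (simp only: mult.assoc)
  consider "n = 0" | "n = Suc 0" | m where "n = Suc (Suc m)"
    by (metis not0_implies_Suc)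
  then show "walk_gf p d t r $ n = (?I + ?R) $ n"
  proof cases
    case (3 m)
    have reflect: "Suc t + i + Suc t = 2 * Suc t + i" for i
      by simp
    have summand: "(if 2 * p dvd t + Suc (Suc m) + r then
        (if 2 * p dvd 2 * Suc t + i then d (level p (Suc t + i)) else 0) *
        walk_sum p d (Suc t) i * walk_sum p d (t + 2 + i) (m - i) else 0) =
      d (level p (Suc t)) * (walk_gf p d (Suc t) (Suc t) $ i * walk_gf p d (2 * p - t) r $ (m - i))"
      if "i \<le> m" for i
    proof (cases "2 * p dvd 2 * Suc t + i")
      case True
      have "level p (Suc t + i) = level p (Suc t)"
        using True by (intro level_reflect) (simp only: reflect)
      moreover have "walk_sum p d (t + 2 + i) (m - i) = walk_sum p d (2 * p - t) (m - i)"
      proof (rule walk_sum_periodic)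
        have "2 * p - t + (2 * Suc t + i) = 2 * p + (t + 2 + i)"
          using assms by simp
        then have "(t + 2 + i) mod (2 * p) = (2 * p - t + (2 * Suc t + i)) mod (2 * p)"
          by (simp only: mod_add_self1)
        also have "\<dots> = (2 * p - t) mod (2 * p)"
          using True by (metis mod_add_right_eq dvd_eq_mod_eq_0 add_0_right)
        finally show "(t + 2 + i) mod (2 * p) = (2 * p - t) mod (2 * p)" .
      qed
      moreover have "2 * p dvd t + Suc (Suc m) + r \<longleftrightarrow> 2 * p dvd 2 * p - t + (m - i) + r"
      proof -
        have "2 * p + (t + Suc (Suc m) + r) = (2 * Suc t + i) + (2 * p - t + (m - i) + r)"
          using assms \<open>i \<le> m\<close> by simp
        then show ?thesis
          by (metis True dvd_add_right_iff dvd_refl)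
      qed
      moreover have "2 * p dvd Suc t + i + Suc t"
        using True by (simp only: reflect)
      ultimately show ?thesis
        using True by (simp only: walk_gf_def fps_nth_Abs_fps if_True) (simp only: mult.assoc mult_zero_right split: if_split; simp)
    next
      case False
      then have "\<not> 2 * p dvd Suc t + i + Suc t"
        by (simp only: reflect not_False_eq_True)
      with False show ?thesis
        by (simp only: walk_gf_def fps_nth_Abs_fps) simp
    qed
    have "walk_gf p d t r $ n = (\<Sum>i\<le>m. if 2 * p dvd t + Suc (Suc m) + r then
        (if 2 * p dvd 2 * Suc t + i then d (level p (Suc t + i)) else 0) *
        walk_sum p d (Suc t) i * walk_sum p d (t + 2 + i) (m - i) else 0)"
      unfolding walk_gf_def fps_nth_Abs_fps 3 walk_sum_Suc_Suc by simp
    also have "\<dots> = (\<Sum>i\<le>m. d (level p (Suc t)) *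
        (walk_gf p d (Suc t) (Suc t) $ i * walk_gf p d (2 * p - t) r $ (m - i)))"
      by (rule sum.cong) (simp_all only: summand atMost_iff)
    also have "\<dots> = d (level p (Suc t)) * (walk_gf p d (Suc t) (Suc t) * walk_gf p d (2 * p - t) r) $ m"
      by (simp only: fps_mult_nth sum_distrib_left atMost_atLeast0)
    also have "\<dots> = (?I + ?R) $ n"
      unfolding R 3 by (simp add: fps_X_power_mult_nth)
    finally show ?thesis .
  qed (simp_all only: R, simp_all add: walk_gf_def fps_X_power_mult_nth)
qed

section \<open>The functional equation\<close>

text \<open>A subword that starts at level \<open>l\<close> heading upwards and returns to level \<open>l\<close> heading downwards
  cannot be empty for \<open>0 < l < p\<close>. Its first letter goes up and is matched with a letter coming
  down, around a subword of the same kind one level higher. What remains is closed at level \<open>l\<close>.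
  At level \<open>p\<close> the walk turns, so that there the subword itself is closed.\<close>

lemma walk_gf_up_down:
  assumes "0 < l" "l \<le> p"
  shows "walk_gf p d l l =
    (\<Prod>m\<in>{l<..p}. fps_X ^ 2 * fps_const (d m)) * (\<Prod>m\<in>{l..p}. walk_gf p d (2 * p - m) m)"
  using \<open>l \<le> p\<close>
proof (induction rule: inc_induct)
  case base
  then show ?case by (simp add: mult_2)
next
  case (step n)
  have "\<not> 2 * p dvd n + n"
    using step \<open>0 < l\<close> by (auto dest!: dvd_imp_le)
  moreover have "{n<..p} = insert (Suc n) {Suc n<..p}" "{n..p} = insert n {Suc n..p}"
    using step by auto
  moreover have "n \<notin> {Suc n..p}" "Suc n \<notin> {Suc n<..p}" by auto
  ultimately show ?case
    using step walk_gf_rec[of n p d n] by (simp add: ac_simps)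
qed

text \<open>The mirror image of the preceding lemma, with the turning point at level \<open>0\<close>.\<close>

lemma walk_gf_down_up:
  assumes "l < p"
  shows "walk_gf p d (2 * p - l) (2 * p - l) =
    (\<Prod>m<l. fps_X ^ 2 * fps_const (d m)) * (\<Prod>m\<le>l. walk_gf p d m (2 * p - m))"
  using assms
proof (induction l)
  case 0
  then show ?case using walk_gf_shift_start[of p d 0 "2 * p"] by simp
next
  case (Suc l)
  have t: "Suc (2 * p - Suc l) = 2 * p - l" "2 * p - (2 * p - Suc l) = Suc l"
    using Suc.prems by auto
  have "\<not> 2 * p dvd (2 * p - Suc l) + (2 * p - Suc l)"
  proof
    assume "2 * p dvd (2 * p - Suc l) + (2 * p - Suc l)"
    also have "(2 * p - Suc l) + (2 * p - Suc l) = 2 * p + 2 * (p - Suc l)"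
      using Suc.prems by simp
    finally have "2 * p dvd 2 * (p - Suc l)"
      by (simp only: dvd_add_triv_left_iff)
    then show False using Suc.prems by (auto dest!: dvd_imp_le)
  qed
  moreover have "level p (2 * p - l) = l"
    using Suc.prems by (simp add: level_diff)
  ultimately show ?case
    using walk_gf_rec[of "2 * p - Suc l" p d "2 * p - Suc l"] Suc
    unfolding t by (simp add: ac_simps)
qed

text \<open>In the system for the closed subwords at all levels the two directions of travel are told apart.
  They have the same generating function, and this symmetry reduces the system to a
  single equation. It requires cancelling \<open>d\<^sub>l\<close>.\<close>

lemma walk_gf_functional_equation:
  fixes d :: "nat \<Rightarrow> 'a :: idom"
  assumes p: "p \<ge> 1" and d: "\<And>l. l \<le> p \<Longrightarrow> d l \<noteq> 0"
  obtains Q where "Q = fps_X ^ (2 * p) * (\<Prod>l\<le>p. fps_const (d l) + Q)"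
    "fps_const (d 0) * walk_gf p d 0 0 = fps_const (d 0) + Q"
proof -
  define c where "c = (fps_X ^ 2 :: 'a fps)"
  define \<delta> where "\<delta> l = fps_const (d l)" for l
  \<comment> \<open>\<open>u l\<close> and \<open>v l\<close> belong to the closed subwords that start and end at level \<open>l\<close> heading
    upwards and downwards, respectively.\<close>
  define u v where "u l = walk_gf p d l (2 * p - l)" and "v l = walk_gf p d (2 * p - l) l" for l
  define Z where "Z l = c ^ p * (\<Prod>m<l. \<delta> m * u m) * (\<Prod>m\<in>{l..p}. \<delta> m * v m)" for l
  \<comment> \<open>The same product arises from the quadratic term in the recursion for \<open>u l\<close>, multiplied by
    \<open>\<delta> l\<close>, and from the one for \<open>v (Suc l)\<close>, multiplied by \<open>\<delta> (Suc l)\<close>.\<close>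
  have Z_Suc: "Z (Suc l) = \<delta> l * (c * \<delta> (Suc l) * walk_gf p d (Suc l) (Suc l) * walk_gf p d (2 * p - l) (2 * p - l))"
    if "l < p" for l
  proof -
    have "c ^ p = c * c ^ l * c ^ (p - Suc l)"
      using that by (simp flip: power_add power_Suc)
    moreover have "{Suc l..p} = insert (Suc l) {Suc l<..p}" using that by auto
    moreover have "walk_gf p d (Suc l) (Suc l) = c ^ (p - Suc l) * prod \<delta> {Suc l<..p} * prod v {Suc l..p}"
      using walk_gf_up_down[of "Suc l" p d] that
      by (simp add: c_def \<delta>_def v_def prod.distrib)
    moreover have "walk_gf p d (2 * p - l) (2 * p - l) = c ^ l * prod \<delta> {..<l} * prod u {..l}"
      using walk_gf_down_up[of l p d] that
      by (simp add: c_def \<delta>_def u_def prod.distrib)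
    ultimately show ?thesis
      by (simp add: Z_def prod.distrib lessThan_Suc_atMost[symmetric] ac_simps)
  qed
  have u: "\<delta> l * u l = \<delta> l + Z (Suc l)" if "l < p" for l
    using walk_gf_rec[of l p d "2 * p - l"] that
    by (simp add: Z_Suc u_def distrib_left) (simp add: c_def \<delta>_def)
  have v: "\<delta> (Suc l) * v (Suc l) = \<delta> (Suc l) + Z (Suc l)" if "l < p" for l
  proof -
    have "Suc (2 * p - Suc l) = 2 * p - l" "2 * p - (2 * p - Suc l) = Suc l" "2 * p - Suc l \<le> 2 * p"
      "2 * p - Suc l + Suc l = 2 * p"
      using that by auto
    moreover have "level p (2 * p - l) = l"
      using that by (simp add: level_diff)
    ultimately have "v (Suc l) = 1 + c * \<delta> l * walk_gf p d (2 * p - l) (2 * p - l) * walk_gf p d (Suc l) (Suc l)"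
      using walk_gf_rec[of "2 * p - Suc l" p d "Suc l"] by (simp add: v_def c_def \<delta>_def)
    then show ?thesis
      using that by (simp add: Z_Suc algebra_simps)
  qed
  \<comment> \<open>At level \<open>0\<close> the walk turns, so that there is only one kind of closed subword.\<close>
  have u0: "u 0 = walk_gf p d 0 0"
    using walk_gf_shift_end[of p d 0 0] by (simp add: u_def)
  have v0: "v 0 = walk_gf p d 0 0"
    using walk_gf_shift_start[of p d 0 0] by (simp add: v_def)
  \<comment> \<open>\<open>Z l\<close> contains the factor \<open>\<delta> l * v l\<close> in the place where \<open>Z (Suc l)\<close> contains \<open>\<delta> l * u l\<close>.\<close>
  have exchange: "Z (Suc l) * (\<delta> l * v l) = Z l * (\<delta> l * u l)" if "l \<le> p" for l
  proof -
    have "{l..p} = insert l {Suc l..p}" using that by auto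
    then show ?thesis by (simp add: Z_def ac_simps)
  qed
  have const: "Z l = Z 0" if "l \<le> p" for l
    using that
  proof (induction l)
    case (Suc l)
    have "Z (Suc l) = Z l"
    proof (cases l)
      case 0
      have "{0..p} = insert 0 {Suc 0..p}" by auto
      then show ?thesis
        by (simp add: 0 Z_def u0 v0 ac_simps)
    next
      case (Suc l')
      with v[of l'] u[of l] \<open>Suc l \<le> p\<close>
      have "\<delta> l * v l = \<delta> l + Z l" "\<delta> l * u l = \<delta> l + Z (Suc l)" by auto
      with exchange[of l] \<open>Suc l \<le> p\<close> have "\<delta> l * Z (Suc l) = \<delta> l * Z l"
        by (simp add: algebra_simps)
      moreover have "\<delta> l \<noteq> 0"
        using d[of l] \<open>Suc l \<le> p\<close> by (simp add: \<delta>_def)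
      ultimately show ?thesis by simp
    qed
    with Suc show ?case by simp
  qed simp
  have v_eq: "\<delta> l * v l = \<delta> l + Z 0" if "l \<le> p" for l
  proof (cases l)
    case 0
    then show ?thesis using u[of 0] p const[of "Suc 0"] by (simp add: u0 v0)
  next
    case (Suc l')
    then show ?thesis using v[of l'] const[of l] that by simp
  qed
  show ?thesis
  proof (rule that[of "Z 0"])
    have "Z 0 = c ^ p * (\<Prod>l\<le>p. \<delta> l * v l)"
      by (simp add: Z_def atMost_atLeast0)
    also have "(\<Prod>l\<le>p. \<delta> l * v l) = (\<Prod>l\<le>p. \<delta> l + Z 0)"
      by (rule prod.cong) (simp_all add: v_eq)
    finally show "Z 0 = fps_X ^ (2 * p) * (\<Prod>l\<le>p. fps_const (d l) + Z 0)"
      by (simp add: c_def \<delta>_def power_mult)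
    show "fps_const (d 0) * walk_gf p d 0 0 = fps_const (d 0) + Z 0"
      using v_eq[of 0] by (simp add: v0 \<delta>_def)
  qed
qed

section \<open>Lagrange inversion\<close>

text \<open>Lagrange inversion for \<open>Q = X\<^sup>N \<Phi>(Q)\<close>, where the exponent \<open>N\<close> accounts for series in which every
  node has size \<open>N\<close>. The induction avoids residues and division: comparing coefficients in
  \<open>Q\<^sup>m = X\<^bsup>Nm\<^esup> \<Phi>(Q)\<^sup>m\<close> expresses \<open>[X\<^bsup>Nn\<^esup>] Q\<^sup>m\<close> by the coefficients of \<open>X\<^bsup>N(n-m)\<^esup>\<close> in the powers of
  \<open>Q\<close>, to which the induction hypothesis applies.\<close>

lemma lagrange_inversion_power:
  fixes \<Phi> Q :: "'a :: {idom, ring_char_0} fps"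
  assumes Q: "Q = fps_X ^ N * (\<Phi> oo Q)" and N: "N > 0"
  shows "m \<le> n \<Longrightarrow> of_nat n * (Q ^ m) $ (N * n) = of_nat m * (\<Phi> ^ n) $ (n - m)"
proof (induction n arbitrary: m rule: less_induct)
  case (less n)
  have Q0: "Q $ 0 = 0"
    by (subst Q) (use N in simp)
  have X_deriv: "(fps_X * fps_deriv f) $ i = of_nat i * f $ i" for f :: "'a fps" and i
    by (cases i) auto
  have pow: "Q ^ i = fps_X ^ (N * i) * (\<Phi> ^ i oo Q)" for i
    by (subst Q) (simp add: power_mult_distrib fps_compose_power[OF Q0] power_mult)
  consider "m = 0" | "m = n" "n > 0" | "0 < m" "m < n"
    using less.prems by linarith
  then show ?case
  proof cases
    case 1
    then show ?thesis using N by (cases "n = 0") auto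
  next
    case 2
    then show ?thesis by (simp add: pow[of n] fps_X_power_mult_nth)
  next
    case 3
    define r where "r = n - m"
    have r: "0 < r" "r < n" "n = r + m" using 3 by (auto simp: r_def)
    \<comment> \<open>The powers \<open>Q\<^sup>i\<close> with \<open>i > r\<close> start beyond \<open>X\<^bsup>Nr\<^esup>\<close>.\<close>
    have small: "of_nat r * (Q ^ i) $ (N * r) = (if i \<le> r then of_nat i * (\<Phi> ^ r) $ (r - i) else 0)" for i
      using less.IH[of r i] r N by (auto simp: pow[of i] fps_X_power_mult_nth)
    have "of_nat r * (Q ^ m) $ (N * n) = of_nat r * (\<Phi> ^ m oo Q) $ (N * r)"
      using r by (simp add: pow[of m] fps_X_power_mult_nth fps_X_power_mult_right_nth algebra_simps)
    also have "\<dots> = (\<Sum>i = 0..N * r. (\<Phi> ^ m) $ i * (of_nat r * (Q ^ i) $ (N * r)))"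
      by (simp add: fps_compose_nth sum_distrib_left algebra_simps)
    also have "\<dots> = (\<Sum>i = 0..r. (\<Phi> ^ m) $ i * (of_nat i * (\<Phi> ^ r) $ (r - i)))"
      using N by (intro sum.mono_neutral_cong_right) (auto simp: small)
    also have "\<dots> = (fps_X * fps_deriv (\<Phi> ^ m) * \<Phi> ^ r) $ r"
      by (subst fps_mult_nth, intro sum.cong) (simp_all only: X_deriv ac_simps)
    finally have "of_nat r * (of_nat n * (Q ^ m) $ (N * n)) =
        (of_nat n * (fps_X * fps_deriv (\<Phi> ^ m) * \<Phi> ^ r)) $ r"
      by (simp add: algebra_simps fps_of_nat flip: fps_of_nat)
    \<comment> \<open>Both \<open>n (\<Phi>\<^sup>m)' \<Phi>\<^sup>r\<close> and \<open>m (\<Phi>\<^sup>n)'\<close> equal \<open>m n \<Phi>' \<Phi>\<^sup>n\<^sup>-\<^sup>1\<close>, because \<open>n = m + r\<close>.\<close>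
    also have "of_nat n * (fps_X * fps_deriv (\<Phi> ^ m) * \<Phi> ^ r) =
        of_nat m * (fps_X * fps_deriv (\<Phi> ^ n))"
    proof -
      have "\<Phi> ^ (n - 1) = \<Phi> ^ (m - 1) * \<Phi> ^ r"
        using 3 r by (simp add: add.commute flip: power_add)
      then show ?thesis
        by (simp add: fps_deriv_power algebra_simps fps_of_nat)
    qed
    also have "\<dots> $ r = of_nat r * (of_nat m * (\<Phi> ^ n) $ r)"
      using r by (simp flip: fps_of_nat)
    finally show ?thesis using r(1) unfolding r_def[symmetric] by simp
  qed
qed

section \<open>Extraction of coefficients\<close>

lemma walk_sum_lagrange:
  fixes d :: "nat \<Rightarrow> 'a :: {idom, ring_char_0}"
  assumes p: "p \<ge> 1" and k: "k \<ge> 1" and d: "\<And>l. l \<le> p \<Longrightarrow> d l \<noteq> 0"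
  shows "of_nat k * (d 0 * walk_sum p d 0 (2 * p * k)) =
    ((\<Prod>l\<le>p. fps_const (d l) + fps_X) ^ k) $ (k - 1)"
proof -
  obtain Q where Q: "Q = fps_X ^ (2 * p) * (\<Prod>l\<le>p. fps_const (d l) + Q)"
    "fps_const (d 0) * walk_gf p d 0 0 = fps_const (d 0) + Q"
    by (rule walk_gf_functional_equation[OF p d])
  have Q0: "Q $ 0 = 0"
    by (subst Q(1)) (use p in simp)
  have "(\<Prod>l\<le>p. fps_const (d l) + fps_X) oo Q = (\<Prod>l\<le>p. fps_const (d l) + Q)"
    by (simp add: fps_compose_prod_distrib[OF Q0] fps_compose_add_distrib Q0)
  with Q(1) have "Q = fps_X ^ (2 * p) * ((\<Prod>l\<le>p. fps_const (d l) + fps_X) oo Q)"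
    by simp
  from lagrange_inversion_power[OF this, of 1 k]
  have "of_nat k * Q $ (2 * p * k) = ((\<Prod>l\<le>p. fps_const (d l) + fps_X) ^ k) $ (k - 1)"
    using p k by simp
  moreover have "Q $ (2 * p * k) = d 0 * walk_sum p d 0 (2 * p * k)"
    using arg_cong[OF Q(2), of "\<lambda>f. f $ (2 * p * k)"] p k by (simp add: walk_gf_def)
  ultimately show ?thesis by simp
qed

text \<open>A choice function \<open>e\<close> records how often \<open>d\<^sub>l\<close>, rather than \<open>X\<close>, is taken from
  the \<open>k\<close> factors \<open>d\<^sub>l + X\<close>.\<close>

lemma coeff_prod_linear_power:
  fixes d :: "'b \<Rightarrow> 'a :: comm_ring_1"
  assumes "finite A"
  shows "((\<Prod>l\<in>A. fps_const (d l) + fps_X) ^ k) $ n =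
    (\<Sum>e\<in>{e \<in> A \<rightarrow>\<^sub>E {..k}. (\<Sum>l\<in>A. k - e l) = n}. \<Prod>l\<in>A. of_nat (k choose e l) * d l ^ e l)"
proof -
  have "(\<Prod>l\<in>A. fps_const (d l) + fps_X) ^ k = (\<Prod>l\<in>A. \<Sum>i\<le>k. of_nat (k choose i) * fps_const (d l) ^ i * fps_X ^ (k - i))"
    by (simp only: prod_power_distrib binomial_ring)
  also have "\<dots> = (\<Sum>e\<in>A \<rightarrow>\<^sub>E {..k}. \<Prod>l\<in>A. of_nat (k choose e l) * fps_const (d l) ^ e l * fps_X ^ (k - e l))"
    by (rule prod_sum_PiE) (use assms in auto)
  also have "\<dots> = (\<Sum>e\<in>A \<rightarrow>\<^sub>E {..k}.
      fps_const (\<Prod>l\<in>A. of_nat (k choose e l) * d l ^ e l) * fps_X ^ (\<Sum>l\<in>A. k - e l))"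
  proof (rule sum.cong)
    fix e
    have "of_nat (k choose e l) * fps_const (d l) ^ e l = fps_const (of_nat (k choose e l) * d l ^ e l)" for l
      by (simp add: fps_const_power flip: fps_of_nat)
    moreover have "(\<Prod>l\<in>A. fps_const (f l)) = fps_const (\<Prod>l\<in>A. f l)" for f :: "'b \<Rightarrow> 'a"
      using assms by (induction A) simp_all
    ultimately show "(\<Prod>l\<in>A. of_nat (k choose e l) * fps_const (d l) ^ e l * fps_X ^ (k - e l)) =
      fps_const (\<Prod>l\<in>A. of_nat (k choose e l) * d l ^ e l) * fps_X ^ (\<Sum>l\<in>A. k - e l)"
      by (simp only: prod.distrib power_sum)
  qed simp
  also have "\<dots> $ n = (\<Sum>e\<in>A \<rightarrow>\<^sub>E {..k}. if (\<Sum>l\<in>A. k - e l) = n then \<Prod>l\<in>A. of_nat (k choose e l) * d l ^ e l else 0)"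
    by (simp add: fps_sum_nth) (intro sum.cong, auto)
  also have "\<dots> = (\<Sum>e\<in>{e \<in> A \<rightarrow>\<^sub>E {..k}. (\<Sum>l\<in>A. k - e l) = n}. \<Prod>l\<in>A. of_nat (k choose e l) * d l ^ e l)"
    by (rule sum.inter_filter[symmetric]) (use assms in \<open>auto intro!: finite_PiE\<close>)
  finally show ?thesis .
qed

definition exponents :: "nat \<Rightarrow> (nat \<Rightarrow> nat) \<Rightarrow> nat \<Rightarrow>\<^sub>0 nat" where
  "exponents p j = (\<Sum>l\<le>p. Poly_Mapping.single l (j l))"

lemma lookup_exponents: "Poly_Mapping.lookup (exponents p j) l = (if l \<le> p then j l else 0)"
  by (simp add: exponents_def lookup_sum lookup_single when_def)

lemma exponents_eq_iff: "exponents p i = exponents p j \<longleftrightarrow> (\<forall>l\<le>p. i l = j l)"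
  by (auto simp: poly_mapping_eq_iff fun_eq_iff lookup_exponents)

lemma prod_d_var_power:
  "(\<Prod>l\<le>p. d_var l ^ j l) = Poly_Mapping.single (exponents p j) 1"
proof -
  have pow: "d_var l ^ n = Poly_Mapping.single (Poly_Mapping.single l n) 1" for l n
    by (induction n) (simp_all add: d_var_def mult_single single_add[symmetric])
  have "(\<Prod>l\<in>A. d_var l ^ j l) = Poly_Mapping.single (\<Sum>l\<in>A. Poly_Mapping.single l (j l)) 1"
    if "finite A" for A
    using that by (induction A) (simp_all add: pow mult_single)
  then show ?thesis by (simp add: exponents_def)
qed

lemma lookup_of_nat_mult:
  "Poly_Mapping.lookup (of_nat n * q) x = of_nat n * Poly_Mapping.lookup (q :: 'a :: monoid_add \<Rightarrow>\<^sub>0 'b :: semiring_1) x"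
  by (induction n) (simp_all add: distrib_right lookup_add)

text \<open>Any \<open>j\<close> with \<open>j\<^sub>0 + \<dots> + j\<^sub>p = pk + 1\<close> and all \<open>j\<^sub>l \<le> k\<close> leaves
  \<open>(p + 1)k - (pk + 1) = k - 1\<close> factors \<open>X\<close>, so the exponent of \<open>X\<close> puts no further condition on
  the monomial. If some \<open>j\<^sub>l\<close> exceeds \<open>k\<close>, both sides vanish.\<close>

lemma lookup_prod_linear_power:
  assumes "(\<Sum>l\<le>p. j l) = p * k + 1"
  shows "Poly_Mapping.lookup (((\<Prod>l\<le>p. fps_const (d_var l) + fps_X) ^ k) $ (k - 1)) (exponents p j) =
    int (\<Prod>l\<le>p. k choose j l)"
proof -
  define j' where "j' = restrict j {..p}"
  have summand: "Poly_Mapping.lookup (\<Prod>l\<le>p. of_nat (k choose e l) * d_var l ^ e l) (exponents p j) =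
     (if e = j' then int (\<Prod>l\<le>p. k choose j l) else 0)" if "e \<in> {..p} \<rightarrow>\<^sub>E {..k}" for e
  proof -
    have "(\<Prod>l\<le>p. of_nat (k choose e l) * d_var l ^ e l) =
        of_nat (\<Prod>l\<le>p. k choose e l) * Poly_Mapping.single (exponents p e) 1"
      by (simp add: prod.distrib prod_d_var_power)
    moreover have "exponents p e = exponents p j \<longleftrightarrow> e = j'"
      using that by (auto simp: exponents_eq_iff j'_def fun_eq_iff PiE_iff extensional_def restrict_def)
    ultimately show ?thesis
      by (simp only: lookup_of_nat_mult lookup_single) (simp add: when_def j'_def)
  qed
  let ?S = "{e \<in> {..p} \<rightarrow>\<^sub>E {..k}. (\<Sum>l\<le>p. k - e l) = k - 1}"
  have fin: "finite ?S" by (simp add: finite_PiE)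
  have "Poly_Mapping.lookup (((\<Prod>l\<le>p. fps_const (d_var l) + fps_X) ^ k) $ (k - 1)) (exponents p j) =
     (\<Sum>e\<in>?S. if e = j' then int (\<Prod>l\<le>p. k choose j l) else 0)"
    unfolding coeff_prod_linear_power[OF finite_atMost] lookup_sum by (rule sum.cong) (auto simp: summand)
  also have "\<dots> = (if j' \<in> ?S then int (\<Prod>l\<le>p. k choose j l) else 0)"
    using fin by simp
  also have "\<dots> = int (\<Prod>l\<le>p. k choose j l)"
  proof (cases "\<forall>l\<le>p. j l \<le> k")
    case True
    have "(\<Sum>l\<le>p. k - j' l) = (\<Sum>l\<le>p. k - j l)"
      by (simp add: j'_def)
    also have "\<dots> = (\<Sum>l\<le>p. k) - (\<Sum>l\<le>p. j l)"
      by (rule sum_subtractf_nat) (use True in simp)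
    also have "\<dots> = k - 1"
      using assms by simp
    finally show ?thesis using True by (auto simp: j'_def)
  next
    case False
    then have "(\<Prod>l\<le>p. k choose j l) = 0"
      by (auto simp: prod_zero_iff not_le binomial_eq_0 intro!: bexI)
    then show ?thesis by simp
  qed
  finally show ?thesis .
qed

section \<open>Adapted partitions of powers of \<open>W\<^sub>0\<close>\<close>

lemma nc_pair_partitions_eq: "nc_pair_partitions m = nc_pairings {0<..m}"
proof -
  have "{1..m} = {0<..m}" by auto
  then show ?thesis by (simp only: nc_pair_partitions_def nc_pairings_def)
qed

lemma length_W0 [simp]: "length (W0 p) = 2 * p"
  by (simp add: W0_def)

lemma nth_concat_replicate:
  "i < k * length xs \<Longrightarrow> concat (replicate k xs) ! i = xs ! (i mod length xs)"
proof (induction k arbitrary: i)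
  case (Suc k)
  then show ?case
    by (cases "i < length xs") (auto simp: nth_append le_mod_geq)
qed simp

lemma letter_at_W0_power:
  assumes "b \<in> {0<..2 * p * k}"
  shows "letter_at (W0_power p k) b =
    (let i = (b - 1) mod (2 * p) in if i < p then Plain (Suc i) else Star (2 * p - i))"
proof -
  define i where "i = (b - 1) mod (2 * p)"
  have "2 * p > 0" using assms by (cases "p = 0") auto
  then have i: "i < 2 * p" by (simp add: i_def)
  have "b - 1 < k * length (W0 p)"
    using assms by (auto simp: ac_simps)
  then have "letter_at (W0_power p k) b = W0 p ! i"
    by (simp add: letter_at_def W0_power_def nth_concat_replicate i_def)
  also have "\<dots> = (if i < p then Plain (Suc i) else Star (2 * p - i))"
    using i by (auto simp: W0_def nth_append rev_nth simp del: upt_Suc)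
  finally show ?thesis by (simp add: i_def Let_def)
qed

text \<open>With \<open>i\<close> and \<open>j\<close> the offsets of the two letters in their copies of \<open>W\<^sub>0\<close>, the letters form a pair
  \<open>l, l\<^sup>*\<close> exactly if \<open>i + j + 1 = 2p\<close>. As \<open>i, j < 2p\<close>, this is a divisibility condition, which
  is insensitive to the copies in which the letters lie.\<close>

lemma letters_match_iff:
  assumes "a \<in> {0<..2 * p * k}" "b \<in> {0<..2 * p * k}"
  shows "(\<exists>l\<in>{1..p}. {letter_at (W0_power p k) a, letter_at (W0_power p k) b} = {Plain l, Star l})
    \<longleftrightarrow> 2 * p dvd a + b - 1"
proof -
  define i j where "i = (a - 1) mod (2 * p)" and "j = (b - 1) mod (2 * p)"
  have p: "2 * p > 0" using assms by (cases "p = 0") auto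
  then have ij: "i < 2 * p" "j < 2 * p" by (simp_all add: i_def j_def)
  have "(\<exists>l\<in>{1..p}. {letter_at (W0_power p k) a, letter_at (W0_power p k) b} = {Plain l, Star l})
    \<longleftrightarrow> i + j + 1 = 2 * p"
    unfolding letter_at_W0_power[OF assms(1)] letter_at_W0_power[OF assms(2)] Let_def
      i_def[symmetric] j_def[symmetric]
    using ij by (auto simp: doubleton_eq_iff)
  also have "\<dots> \<longleftrightarrow> 2 * p dvd i + j + 1"
  proof
    assume "2 * p dvd i + j + 1"
    then obtain q where q: "i + j + 1 = 2 * p * q" ..
    with ij have "2 * p * q < 2 * p * 2" by linarith
    then have "q < 2" by simp
    with q have "q = 1" by (cases q) auto
    with q show "i + j + 1 = 2 * p" by simp
  qed simp
  also have "\<dots> \<longleftrightarrow> 2 * p dvd (a - 1) + (b - 1) + 1"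
    unfolding dvd_eq_mod_eq_0 i_def j_def by (simp only: mod_add_cong[OF mod_add_eq refl])
  also have "(a - 1) + (b - 1) + 1 = a + b - 1"
    using assms by (cases a; cases b) auto
  finally show ?thesis .
qed

lemma right_legs_eq_Max_image:
  assumes "\<pi> \<in> nc_pairings A"
  shows "right_legs \<pi> = Max ` \<pi>" "inj_on Max \<pi>"
proof -
  have block: "\<exists>x y. B = {x, y} \<and> x < y \<and> Max B = y" if "B \<in> \<pi>" for B
    by (rule nc_pairings_block[OF assms that]) (auto simp: max_def)
  show "right_legs \<pi> = Max ` \<pi>"
  proof (intro equalityI subsetI)
    fix b assume "b \<in> right_legs \<pi>"
    then obtain a where "a < b" "{a, b} \<in> \<pi>" by (auto simp: right_legs_def)
    then show "b \<in> Max ` \<pi>" by (intro image_eqI[of _ _ "{a, b}"]) auto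
  next
    fix b assume "b \<in> Max ` \<pi>"
    then show "b \<in> right_legs \<pi>" using block by (fastforce simp: right_legs_def)
  qed
  show "inj_on Max \<pi>"
  proof (rule inj_onI)
    fix B C assume BC: "B \<in> \<pi>" "C \<in> \<pi>" "Max B = Max C"
    then have "Max B \<in> B \<inter> C" using block[of B] block[of C] by auto
    then show "B = C"
      using nc_pairingsD(1)[OF assms] BC(1,2) by (auto simp: partition_on_def disjoint_def)
  qed
qed

lemma right_legs_subset: "\<pi> \<in> nc_pairings A \<Longrightarrow> right_legs \<pi> \<subseteq> A"
  using nc_pairings_block_subset by (fastforce simp: right_legs_def)

lemma card_right_legs:
  assumes "\<pi> \<in> nc_pairings A" "finite A"
  shows "2 * card (right_legs \<pi>) = card A"
proof -
  note part = nc_pairingsD(1)[OF assms(1)]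
  have "card (right_legs \<pi>) = card \<pi>"
    using right_legs_eq_Max_image[OF assms(1)] by (simp add: card_image)
  moreover have "2 * card \<pi> = card (\<Union> \<pi>)"
  proof (rule card_partition)
    show "finite \<pi>" "finite (\<Union> \<pi>)"
      using part assms(2) finite_elements partition_onD1 by blast+
    show "\<And>B. B \<in> \<pi> \<Longrightarrow> card B = 2" by (rule nc_pairingsD(2)[OF assms(1)])
    show "\<And>B C. B \<in> \<pi> \<Longrightarrow> C \<in> \<pi> \<Longrightarrow> B \<noteq> C \<Longrightarrow> B \<inter> C = {}"
      using part by (auto simp: partition_on_def disjoint_def)
  qed
  ultimately show ?thesis using partition_onD1[OF part] by simp
qed

text \<open>Both \<open>l + 1\<close> and \<open>l\<^sup>*\<close> are steps that depart from level \<open>l\<close>, and no other letters are.\<close>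

lemma jstat_eq_card_level:
  assumes \<pi>: "\<pi> \<in> nc_pairings {0<..2 * p * k}"
  shows "jstat p k l \<pi> = card {b \<in> right_legs \<pi>. level p (b - 1) = l}"
proof -
  have b: "b \<in> {0<..2 * p * k}" if "b \<in> right_legs \<pi>" for b
    using right_legs_subset[OF \<pi>] that by auto
  have fin: "finite (right_legs \<pi>)"
    using right_legs_subset[OF \<pi>] by (rule finite_subset) simp
  have lev: "level p (b - 1) = l \<longleftrightarrow> letter_at (W0_power p k) b = Plain (l + 1) \<or> letter_at (W0_power p k) b = Star l"
    if "b \<in> right_legs \<pi>" for b
    unfolding letter_at_W0_power[OF b[OF that]] by (auto simp: level_def Let_def)
  have "{b \<in> right_legs \<pi>. level p (b - 1) = l} = R_plain p k (l + 1) \<pi> \<union> R_star p k l \<pi>"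
    unfolding R_plain_def R_star_def using lev by blast
  moreover have "R_plain p k (l + 1) \<pi> \<inter> R_star p k l \<pi> = {}"
    "finite (R_plain p k (l + 1) \<pi>)" "finite (R_star p k l \<pi>)"
    using fin by (auto simp: R_plain_def R_star_def)
  ultimately show ?thesis
    by (simp add: jstat_def card_Un_disjoint)
qed

lemma level_bound: "level p e \<le> p"
  by (auto simp: level_def Let_def)

lemma sum_jstat:
  assumes "\<pi> \<in> nc_pairings {0<..2 * p * k}"
  shows "(\<Sum>l\<le>p. jstat p k l \<pi>) = p * k"
proof -
  have fin: "finite (right_legs \<pi>)"
    using right_legs_subset[OF assms] by (rule finite_subset) simp
  have "(\<Sum>l\<le>p. jstat p k l \<pi>) = (\<Sum>l\<le>p. \<Sum>b\<in>{b \<in> right_legs \<pi>. level p (b - 1) = l}. 1)"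
    by (simp add: jstat_eq_card_level[OF assms])
  also have "\<dots> = (\<Sum>b\<in>right_legs \<pi>. 1)"
    by (rule sum.group) (use fin level_bound in auto)
  also have "\<dots> = p * k"
    using card_right_legs[OF assms] by simp
  finally show ?thesis .
qed

lemma prod_block_weight:
  assumes \<pi>: "\<pi> \<in> nc_pairings {0<..2 * p * k}"
  shows "(\<Prod>B\<in>\<pi>. block_weight p d B) = (if adapted p k \<pi> then \<Prod>l\<le>p. d l ^ jstat p k l \<pi> else 0)"
proof -
  have fin: "finite (right_legs \<pi>)" "finite \<pi>"
    using right_legs_subset[OF \<pi>] finite_elements[OF _ nc_pairingsD(1)[OF \<pi>]]
    by (auto intro: finite_subset)
  have match: "(\<exists>l\<in>{1..p}. {letter_at (W0_power p k) a, letter_at (W0_power p k) b} = {Plain l, Star l})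
      \<longleftrightarrow> 2 * p dvd Min {a, b} + Max {a, b} - 1" if "{a, b} \<in> \<pi>" for a b
  proof -
    have "a \<in> {0<..2 * p * k}" "b \<in> {0<..2 * p * k}"
      using nc_pairings_block_subset[OF \<pi> that] by auto
    moreover have "Min {a, b} + Max {a, b} = a + b"
      by (simp add: min_def max_def)
    ultimately show ?thesis by (simp only: letters_match_iff)
  qed
  have "adapted p k \<pi> \<longleftrightarrow> (\<forall>a b. {a, b} \<in> \<pi> \<longrightarrow> 2 * p dvd Min {a, b} + Max {a, b} - 1)"
    unfolding adapted_def using match by blast
  also have "\<dots> \<longleftrightarrow> (\<forall>B\<in>\<pi>. 2 * p dvd Min B + Max B - 1)"
    using nc_pairings_block[OF \<pi>] by metis
  finally have adapted: "adapted p k \<pi> \<longleftrightarrow> (\<forall>B\<in>\<pi>. 2 * p dvd Min B + Max B - 1)" .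
  show ?thesis
  proof (cases "adapted p k \<pi>")
    case True
    have "(\<Prod>B\<in>\<pi>. block_weight p d B) = (\<Prod>B\<in>\<pi>. d (level p (Max B - 1)))"
      using True adapted by (intro prod.cong) (auto simp: block_weight_def)
    also have "\<dots> = (\<Prod>b\<in>right_legs \<pi>. d (level p (b - 1)))"
      using right_legs_eq_Max_image[OF \<pi>] by (simp add: prod.reindex)
    also have "\<dots> = (\<Prod>l\<le>p. \<Prod>b\<in>{b \<in> right_legs \<pi>. level p (b - 1) = l}. d (level p (b - 1)))"
      by (rule prod.group[symmetric]) (use fin level_bound in auto)
    also have "\<dots> = (\<Prod>l\<le>p. d l ^ jstat p k l \<pi>)"
      by (simp add: jstat_eq_card_level[OF \<pi>])
    finally show ?thesis using True by simp
  next
    case False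
    with adapted fin show ?thesis
      by (auto simp: block_weight_def intro!: prod_zero)
  qed
qed

lemma P_eq_walk_sum: "P p k = walk_sum p d_var 0 (2 * p * k)"
proof -
  have "NC2 p k = {\<pi> \<in> nc_pairings {0<..2 * p * k}. adapted p k \<pi>}"
    by (simp add: NC2_def nc_pair_partitions_eq)
  then show ?thesis
    by (simp add: P_def nc_sum_def prod_block_weight finite_nc_pairings sum.inter_filter cong: sum.cong)
qed

lemma finite_NC2: "finite (NC2 p k)"
  by (simp add: NC2_def nc_pair_partitions_eq finite_nc_pairings)

lemma lookup_P: "Poly_Mapping.lookup (P p k) (exponents p j) = int (N0 p k j)"
proof -
  have "Poly_Mapping.lookup (P p k) (exponents p j) =
      (\<Sum>\<pi>\<in>NC2 p k. if \<forall>l\<le>p. jstat p k l \<pi> = j l then 1 else 0)"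
    unfolding P_def prod_d_var_power lookup_sum
    by (rule sum.cong) (auto simp: lookup_single when_def exponents_eq_iff)
  also have "\<dots> = int (N0 p k j)"
    by (simp add: N0_def finite_NC2 flip: sum.inter_filter)
  finally show ?thesis .
qed

text \<open>The factor \<open>d\<^sub>0\<close> in \<open>walk_sum_lagrange\<close> shifts the exponent of \<open>d\<^sub>0\<close> by one.\<close>

lemma lookup_d_var_mult:
  "Poly_Mapping.lookup (d_var l * q) (Poly_Mapping.single l 1 + x) = Poly_Mapping.lookup q x"
proof (induction q rule: update_induct)
  case const
  show ?case by simp
next
  case (update q y c)
  have "Poly_Mapping.update y c q = q + Poly_Mapping.single y c"
    using update.hyps by (intro poly_mapping_eqI) (auto simp: lookup_update lookup_add lookup_single in_keys_iff when_def)
  with update.IH show ?case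
    by (simp add: distrib_left lookup_add d_var_def mult_single lookup_single when_def)
qed

lemma d_var_nonzero: "d_var l \<noteq> 0"
  by (metis d_var_def lookup_single_eq lookup_zero zero_neq_one)

theorem theorem4p1:
  fixes p k :: nat and j :: "nat \<Rightarrow> nat"
  assumes "p \<ge> 1"
  shows "int (N0 p k j) = Poly_Mapping.lookup (P p k) (\<Sum>l\<le>p. Poly_Mapping.single l (j l))
    \<and> (k \<ge> 1 \<and> (\<Sum>l\<le>p. j l) = p * k \<longrightarrow>
         real (N0 p k j) =
           1 / real k * real (k choose (j 0 + 1)) * (\<Prod>l = 1..p. real (k choose (j l))))
    \<and> (k = 0 \<and> (\<forall>l\<le>p. j l = 0) \<longrightarrow> N0 p k j = 1)
    \<and> (\<not> (k \<ge> 1 \<and> (\<Sum>l\<le>p. j l) = p * k) \<and> \<not> (k = 0 \<and> (\<forall>l\<le>p. j l = 0)) \<longrightarrow>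
         N0 p k j = 0)"
proof (intro conjI impI)
  show "int (N0 p k j) = Poly_Mapping.lookup (P p k) (\<Sum>l\<le>p. Poly_Mapping.single l (j l))"
    by (simp only: lookup_P flip: exponents_def)
next
  assume *: "k \<ge> 1 \<and> (\<Sum>l\<le>p. j l) = p * k"
  then have k: "k \<ge> 1" by simp
  \<comment> \<open>The exponents \<open>j\<close> in \<open>P\<^sub>k\<close> become \<open>j'\<close> in \<open>d\<^sub>0 P\<^sub>k\<close>.\<close>
  define j' where "j' = j(0 := j 0 + 1)"
  have set: "{..p} = insert 0 {1..p}" by auto
  have "(\<Sum>l\<le>p. j' l) = p * k + 1"
    using * by (simp add: set j'_def)
  then have "Poly_Mapping.lookup (of_nat k * (d_var 0 * P p k)) (exponents p j') = int (\<Prod>l\<le>p. k choose j' l)"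
    unfolding P_eq_walk_sum walk_sum_lagrange[where d = d_var, OF assms k d_var_nonzero]
    by (rule lookup_prod_linear_power)
  moreover have "exponents p j' = Poly_Mapping.single 0 1 + exponents p j"
    by (auto simp: poly_mapping_eq_iff fun_eq_iff lookup_add lookup_exponents lookup_single when_def j'_def)
  ultimately have "int (k * N0 p k j) = int (\<Prod>l\<le>p. k choose j' l)"
    by (simp only: lookup_of_nat_mult lookup_d_var_mult lookup_P of_nat_mult)
  then have "k * N0 p k j = (k choose (j 0 + 1)) * (\<Prod>l = 1..p. k choose j l)"
    by (simp only: of_nat_eq_iff) (simp add: set j'_def)
  then have "real k * real (N0 p k j) = real (k choose (j 0 + 1)) * (\<Prod>l = 1..p. real (k choose j l))"
    by (metis of_nat_mult of_nat_prod)
  then show "real (N0 p k j) =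
      1 / real k * real (k choose (j 0 + 1)) * (\<Prod>l = 1..p. real (k choose (j l)))"
    using * by (simp add: field_simps)
next
  assume *: "k = 0 \<and> (\<forall>l\<le>p. j l = 0)"
  have "NC2 p 0 = {{}}"
    by (auto simp: NC2_def nc_pair_partitions_eq adapted_def)
  moreover have "jstat p 0 l {} = 0" for l
    by (simp add: jstat_def R_plain_def R_star_def right_legs_def)
  ultimately have "{\<pi> \<in> NC2 p k. \<forall>l\<le>p. jstat p k l \<pi> = j l} = {{}}"
    using * by auto
  then show "N0 p k j = 1" by (simp add: N0_def)
next
  assume *: "\<not> (k \<ge> 1 \<and> (\<Sum>l\<le>p. j l) = p * k) \<and> \<not> (k = 0 \<and> (\<forall>l\<le>p. j l = 0))"
  have "(\<Sum>l\<le>p. j l) \<noteq> p * k"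
    using * by (cases "k = 0") auto
  moreover have "(\<Sum>l\<le>p. j l) = p * k" if "\<pi> \<in> NC2 p k" "\<forall>l\<le>p. jstat p k l \<pi> = j l" for \<pi>
  proof -
    have "(\<Sum>l\<le>p. j l) = (\<Sum>l\<le>p. jstat p k l \<pi>)" using that(2) by simp
    also have "\<dots> = p * k"
      using that(1) by (intro sum_jstat) (simp add: NC2_def nc_pair_partitions_eq)
    finally show ?thesis .
  qed
  ultimately have "{\<pi> \<in> NC2 p k. \<forall>l\<le>p. jstat p k l \<pi> = j l} = {}" by blast
  then show "N0 p k j = 0" by (simp only: N0_def card.empty)
qed

end
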